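(* Let $X=\{x_{1},\ldots,x_{l}\}$ and $Y=\{-y_{1},\ldots,-y_{m}\}$ be disjoint nonempty sets of even integers, where $x_{1}>\cdots>x_{l}$ are non-negative even integers and $y_{1}<\cdots<y_{m}$ are positive even integers, and suppose $X\cup Y\neq\{0\}$. Let $L=\sum_{i=1}^{l}x_{i}$, $M=\sum_{i=1}^{m}y_{i}$ and $n=lM+mL$. Then there exists a near tournament of order $n$ whose imbalance set is $X\cup Y$.
   Context: A tournament is an orientation of a complete simple graph; its order is its number of vertices. A partial tournament is a digraph obtained from a tournament by removing one or more arcs. A near tournament is a partial tournament in which each vertex is joined (by an arc in one direction) to all other vertices except exactly one. The imbalance of a vertex $v$ in a digraph is $d^{+}(v)-d^{-}(v)$ (outdegree minus indegree), and the imbalance set of a digraph is the set of imbalances of its vertices.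
   Formalization: The formal theorem adds the hypothesis X ≠ {0}; for X = {0} the claim is false for every Y, since imbalances sum to 0 and cannot form the set {0} together with only negative integers (e.g. X = {0}, Y = {-2}, n = 2). *)

theory Defs
  imports "Graph_Theory.Pair_Digraph"
begin

text \<open>
  A \<open>pair_digraph\<close> is finite and has neither loops nor parallel arcs; digons
  \<open>(u, v)\<close>, \<open>(v, u)\<close> are possible and are excluded by \<open>tournament\<close>.
\<close>

definition tournament :: "'a pair_pre_digraph \<Rightarrow> bool" where
  "tournament T \<longleftrightarrow> pair_digraph T \<and>
     (\<forall>u \<in> pverts T. \<forall>v \<in> pverts T. u \<noteq> v \<longrightarrow> ((u, v) \<in> parcs T) \<noteq> ((v, u) \<in> parcs T))"

definition partial_tournament :: "'a pair_pre_digraph \<Rightarrow> bool" where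
  "partial_tournament G \<longleftrightarrow> (\<exists>T A. tournament T \<and> A \<subseteq> parcs T \<and> A \<noteq> {} \<and>
     pverts G = pverts T \<and> parcs G = parcs T - A)"

definition joined :: "'a pair_pre_digraph \<Rightarrow> 'a \<Rightarrow> 'a \<Rightarrow> bool" where
  "joined G u v \<longleftrightarrow> (u, v) \<in> parcs G \<or> (v, u) \<in> parcs G"

definition near_tournament :: "'a pair_pre_digraph \<Rightarrow> bool" where
  "near_tournament G \<longleftrightarrow> partial_tournament G \<and>
     (\<forall>u \<in> pverts G. \<exists>!v. v \<in> pverts G \<and> v \<noteq> u \<and> \<not> joined G u v)"

definition imbalance :: "'a pair_pre_digraph \<Rightarrow> 'a \<Rightarrow> int" where
  "imbalance G v = int (out_degree G v) - int (in_degree G v)"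

definition imbalance_set :: "'a pair_pre_digraph \<Rightarrow> int set" where
  "imbalance_set G = imbalance G ` pverts G"

end

theory Submission
  imports Defs
begin

text \<open>
  Doubling turns an oriented graph \<open>H\<close> into a near tournament: replace each vertex by two non-adjacent
  copies, each arc by the four arcs between the copies, and each non-adjacent pair of vertices by a
  directed 4-cycle on the copies. The 4-cycles do not affect imbalances, so each copy has twice the
  imbalance of the original vertex. It therefore suffices to realise the halved imbalances by an oriented
  graph. With \<open>a\<^sub>i = x\<^sub>i / 2\<close> and \<open>b\<^sub>j = y\<^sub>j / 2\<close>, take the disjoint union over all \<open>(i, j)\<close> of the complete
  bipartite graphs directed from \<open>b\<^sub>j\<close> sources, of imbalance \<open>a\<^sub>i\<close>, to \<open>a\<^sub>i\<close> sinks, of imbalance \<open>-b\<^sub>j\<close>.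
\<close>

text \<open>Counting both degrees by indicators turns the imbalance into a single sum over the
  vertices, which can then be regrouped by pairs of copies.\<close>

lemma imbalance_eq_sum:
  fixes G :: "'a pair_pre_digraph"
  assumes "finite (pverts G)" "parcs G \<subseteq> pverts G \<times> pverts G"
  shows "imbalance G v = (\<Sum>u\<in>pverts G. of_bool ((v, u) \<in> parcs G) - of_bool ((u, v) \<in> parcs G))"
proof -
  have "out_arcs G v = Pair v ` {u \<in> pverts G. (v, u) \<in> parcs G}"
    using assms(2) by (auto simp: out_arcs_def)
  then have out: "out_degree G v = card {u \<in> pverts G. (v, u) \<in> parcs G}"
    by (simp add: out_degree_def card_image inj_on_def)
  have "in_arcs G v = (\<lambda>u. (u, v)) ` {u \<in> pverts G. (u, v) \<in> parcs G}"
    using assms(2) by (auto simp: in_arcs_def)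
  then have inn: "in_degree G v = card {u \<in> pverts G. (u, v) \<in> parcs G}"
    by (simp add: in_degree_def card_image inj_on_def)
  show ?thesis
    using assms(1) by (simp add: imbalance_def out inn sum_subtractf Int_def of_bool_def
        flip: sum.inter_filter)
qed

definition double_verts :: "nat set \<Rightarrow> nat set" where
  "double_verts V = {v. v div 2 \<in> V}"

text \<open>The copies of \<open>h\<close> are \<open>2 * h\<close> and \<open>2 * h + 1\<close>; the last disjunct produces the directed 4-cycles.\<close>

definition double_arc :: "(nat \<Rightarrow> nat \<Rightarrow> bool) \<Rightarrow> nat \<Rightarrow> nat \<Rightarrow> bool" where
  "double_arc R u v \<longleftrightarrow> u div 2 \<noteq> v div 2 \<and>
     (R (u div 2) (v div 2) \<or>
      \<not> R (u div 2) (v div 2) \<and> \<not> R (v div 2) (u div 2) \<and> ((even u \<longleftrightarrow> even v) \<longleftrightarrow> u < v))"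

definition double_graph :: "nat set \<Rightarrow> (nat \<Rightarrow> nat \<Rightarrow> bool) \<Rightarrow> nat pair_pre_digraph" where
  "double_graph V R = \<lparr> pverts = double_verts V,
     parcs = {(u, v). u \<in> double_verts V \<and> v \<in> double_verts V \<and> double_arc R u v} \<rparr>"

lemma double_verts_eq_image: "double_verts V = (\<lambda>(k, e). 2 * k + e) ` (V \<times> {0, 1})"
proof -
  have "v \<in> (\<lambda>(k, e). 2 * k + e) ` (V \<times> {0, 1})" if "v div 2 \<in> V" for v :: nat
    by (rule image_eqI[where x = "(v div 2, v mod 2)"]) (use that in auto)
  then show ?thesis
    by (auto simp: double_verts_def)
qed

lemma inj_on_double: "inj_on (\<lambda>(k, e). 2 * k + e :: nat) (V \<times> {0, 1})"
  by (auto simp: inj_on_def) presburger+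

lemma finite_double_verts: "finite V \<Longrightarrow> finite (double_verts V)"
  by (simp add: double_verts_eq_image)

lemma card_double_verts: "card (double_verts V) = 2 * card V"
  by (simp add: double_verts_eq_image card_image[OF inj_on_double] card_cartesian_product
      del: One_nat_def)

lemma sum_double_verts:
  fixes f :: "nat \<Rightarrow> int"
  shows "sum f (double_verts V) = (\<Sum>k\<in>V. f (2 * k) + f (2 * k + 1))"
  unfolding double_verts_eq_image sum.reindex[OF inj_on_double] sum.cartesian_product' by simp

lemma double_arc_div_neq: "double_arc R u v \<Longrightarrow> u div 2 \<noteq> v div 2"
  by (simp add: double_arc_def)

text \<open>If neither direction holds in \<open>R\<close>, exchanging \<open>u\<close> and
  \<open>v\<close> keeps the parity comparison and reverses \<open>u < v\<close>, so exactly one arc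
  is present. Otherwise asymmetry of \<open>R\<close> decides.\<close>

lemma double_arc_tournament:
  assumes "asymp R" "u div 2 \<noteq> v div 2"
  shows "double_arc R u v \<noteq> double_arc R v u"
  using assms by (auto simp: double_arc_def dest: asympD)

text \<open>The only unjoined pairs are the two copies of one vertex, so each copy misses exactly
  its twin, and one arc inside every such pair completes the graph to a tournament.\<close>

lemma near_tournament_double:
  assumes "finite V" "V \<noteq> {}" and R: "asymp R"
  shows "near_tournament (double_graph V R)"
proof -
  let ?G = "double_graph V R" and ?P = "double_verts V"
  define A where "A = {(u, v). u \<in> ?P \<and> v \<in> ?P \<and> u div 2 = v div 2 \<and> u < v}"
  define T where "T = \<lparr> pverts = ?P, parcs = parcs ?G \<union> A \<rparr>"
  have "tournament T"
    unfolding tournament_def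
  proof (intro conjI ballI impI)
    show "pair_digraph T"
      by unfold_locales
        (use finite_double_verts[OF assms(1)] in
          \<open>auto simp: T_def double_graph_def A_def dest: double_arc_div_neq
             intro: finite_subset[of _ "?P \<times> ?P"]\<close>)
    fix u v assume "u \<in> pverts T" "v \<in> pverts T" "u \<noteq> v"
    then show "((u, v) \<in> parcs T) \<noteq> ((v, u) \<in> parcs T)"
      using double_arc_tournament[OF R, of u v] double_arc_div_neq[of R u v]
        double_arc_div_neq[of R v u]
      by (cases "u div 2 = v div 2") (auto simp: T_def double_graph_def A_def)
  qed
  \<comment> \<open>A partial tournament must lack at least one arc; this is where
    \<open>V \<noteq> {}\<close> enters.\<close>
  moreover obtain k where "k \<in> V"
    using assms(2) by blast
  then have "(2 * k, 2 * k + 1) \<in> A"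
    by (simp add: A_def double_verts_def)
  then have "A \<noteq> {}"
    by blast
  moreover have "parcs ?G \<inter> A = {}"
    by (auto simp: double_graph_def A_def dest: double_arc_div_neq)
  then have "parcs ?G = parcs T - A"
    by (auto simp: T_def)
  moreover have "pverts ?G = pverts T" "A \<subseteq> parcs T"
    by (simp_all add: T_def double_graph_def)
  ultimately have "partial_tournament ?G"
    unfolding partial_tournament_def by blast
  moreover have "\<exists>!v. v \<in> ?P \<and> v \<noteq> u \<and> \<not> joined ?G u v" if u: "u \<in> ?P" for u
  proof -
    have joined: "joined ?G u v \<longleftrightarrow> u div 2 \<noteq> v div 2" if "v \<in> ?P" for v
    proof -
      have "joined ?G u v \<longleftrightarrow> double_arc R u v \<or> double_arc R v u"
        using u that by (simp add: joined_def double_graph_def)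
      then show ?thesis
        using double_arc_tournament[OF R, of u v] by (metis double_arc_div_neq)
    qed
    \<comment> \<open>The twin of \<open>u\<close>: the only other number with the same quotient by
      2.\<close>
    let ?w = "if even u then u + 1 else u - 1"
    have w: "v \<noteq> u \<and> u div 2 = v div 2 \<longleftrightarrow> v = ?w" for v
      by (cases "even u") (auto elim!: evenE oddE)
    have "?w \<in> ?P"
      using u w[THEN iffD2, OF refl] by (simp only: double_verts_def mem_Collect_eq)
    show ?thesis
      by (rule ex1I[of _ ?w]) (use \<open>?w \<in> ?P\<close> joined w in blast)+
  qed
  ultimately show ?thesis
    by (simp add: near_tournament_def double_graph_def)
qed

text \<open>An arc of \<open>R\<close> counts twice, once per copy of its other end, while a
  non-adjacent vertex yields one outgoing and one incoming arc, which cancel.\<close>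

lemma imbalance_double:
  assumes "finite V" and R: "asymp R" and v: "v \<in> double_verts V"
  shows "imbalance (double_graph V R) v =
     2 * (int (card {k \<in> V. R (v div 2) k}) - int (card {k \<in> V. R k (v div 2)}))"
proof -
  let ?h = "v div 2"
  have "imbalance (double_graph V R) v =
      (\<Sum>u\<in>double_verts V. of_bool (double_arc R v u) - of_bool (double_arc R u v))"
    using v finite_double_verts[OF assms(1)]
    by (subst imbalance_eq_sum) (auto simp: double_graph_def intro!: sum.cong)
  also have "\<dots> = (\<Sum>k\<in>V. 2 * (of_bool (R ?h k) - of_bool (R k ?h)))"
    unfolding sum_double_verts
  proof (rule sum.cong[OF refl])
    fix k
    \<comment> \<open>For \<open>k \<noteq> ?h\<close> both copies of \<open>k\<close> lie on the
      same side of \<open>v\<close>. Since their parities differ, the 4-cycle rule directs one arc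
      out of \<open>v\<close> and the other into it.\<close>
    have lt: "v < 2 * k \<longleftrightarrow> ?h < k" "v < 2 * k + 1 \<longleftrightarrow> ?h < k"
      "2 * k < v \<longleftrightarrow> k < ?h" "2 * k + 1 < v \<longleftrightarrow> k < ?h" if "k \<noteq> ?h"
      using that by presburger+
    show "(of_bool (double_arc R v (2 * k)) - of_bool (double_arc R (2 * k) v) +
       (of_bool (double_arc R v (2 * k + 1)) - of_bool (double_arc R (2 * k + 1) v)) :: int) =
       2 * (of_bool (R ?h k) - of_bool (R k ?h))"
    proof (cases "k = ?h")
      case True
      have "\<not> R k k" using R by (auto dest: asympD)
      then show ?thesis using True by (simp add: double_arc_def)
    next
      case False
      have d: "(2 * k) div 2 = k" "(2 * k + 1) div 2 = k" by simp_all
      show ?thesis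
        using False asympD[OF R, of k ?h]
        unfolding double_arc_def d lt[OF False]
        by (cases "R k ?h"; cases "R ?h k"; cases "even v"; cases "?h < k") auto
    qed
  qed
  also have "\<dots> = 2 * (int (card {k \<in> V. R ?h k}) - int (card {k \<in> V. R k ?h}))"
    using assms(1) by (simp add: sum_subtractf Int_def flip: sum_distrib_left)
  finally show ?thesis .
qed

text \<open>The doubling is arithmetic on natural numbers; \<open>to_nat\<close> makes it available
  for vertices of any countable type, such as triples.\<close>

lemma near_tournament_from_oriented_graph:
  fixes W :: "'a :: countable set" and E :: "'a \<Rightarrow> 'a \<Rightarrow> bool"
  assumes "finite W" "W \<noteq> {}" and E: "asymp E"
  obtains G :: "nat pair_pre_digraph" where "near_tournament G" "card (pverts G) = 2 * card W"
    "imbalance_set G =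
       (\<lambda>w. 2 * (int (card {z \<in> W. E w z}) - int (card {z \<in> W. E z w}))) ` W"
proof -
  define V where "V = to_nat ` W"
  define R where "R h k = E (from_nat h) (from_nat k)" for h k :: nat
  let ?G = "double_graph V R"
  have R: "asymp R" and V: "finite V" "V \<noteq> {}" "card V = card W"
    using assms by (auto simp: V_def R_def card_image intro!: asympI dest: asympD)
  have card_V: "card {k \<in> V. Q (from_nat k)} = card {z \<in> W. Q z}" for Q
  proof -
    have "{k \<in> V. Q (from_nat k)} = to_nat ` {z \<in> W. Q z}"
      by (auto simp: V_def)
    then show ?thesis by (simp add: card_image)
  qed
  have "imbalance_set ?G =
      (\<lambda>v. 2 * (int (card {k \<in> V. R (v div 2) k}) - int (card {k \<in> V. R k (v div 2)}))) `
        double_verts V"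
    unfolding imbalance_set_def
    by (rule image_cong)
      (simp_all add: double_graph_def imbalance_double[OF V(1) R, unfolded double_graph_def])
  \<comment> \<open>The imbalance depends only on \<open>v div 2\<close>, so the image over all
    copies collapses to one over \<open>V\<close>.\<close>
  also have "\<dots> = (\<lambda>h. 2 * (int (card {k \<in> V. R h k}) - int (card {k \<in> V. R k h}))) `
      (\<lambda>v. v div 2) ` double_verts V"
    by (simp add: image_image)
  also have "(\<lambda>v. v div 2) ` double_verts V = V"
  proof -
    have "k \<in> (\<lambda>v. v div 2) ` double_verts V" if "k \<in> V" for k
      by (rule image_eqI[where x = "2 * k"]) (use that in \<open>auto simp: double_verts_def\<close>)
    then show ?thesis by (auto simp: double_verts_def)
  qed
  also have "(\<lambda>h. 2 * (int (card {k \<in> V. R h k}) - int (card {k \<in> V. R k h}))) ` V =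
      (\<lambda>w. 2 * (int (card {z \<in> W. E w z}) - int (card {z \<in> W. E z w}))) ` W"
  proof -
    have "card {k \<in> V. R (to_nat w) k} = card {z \<in> W. E w z}"
      "card {k \<in> V. R k (to_nat w)} = card {z \<in> W. E z w}" for w
      using card_V[of "E w"] card_V[of "\<lambda>z. E z w"] by (simp_all add: R_def)
    then show ?thesis
      by (subst V_def) (simp add: image_image)
  qed
  finally have "imbalance_set ?G = \<dots>" .
  moreover have "card (pverts ?G) = 2 * card W"
    by (simp add: double_graph_def card_double_verts V)
  ultimately show thesis
    using that near_tournament_double[OF V(1,2) R] by blast
qed

theorem theorem3p2:
  fixes l m n :: nat and x y :: "nat \<Rightarrow> int" and X Y :: "int set" and L M :: int
  assumes X_def: "X = x ` {1..l}"
    and Y_def: "Y = (\<lambda>j. - y j) ` {1..m}"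
    and X_nonempty: "X \<noteq> {}" and Y_nonempty: "Y \<noteq> {}"
    and disjoint: "X \<inter> Y = {}"
    and x_decreasing: "\<And>i j. 1 \<le> i \<Longrightarrow> i < j \<Longrightarrow> j \<le> l \<Longrightarrow> x i > x j"
    and y_increasing: "\<And>i j. 1 \<le> i \<Longrightarrow> i < j \<Longrightarrow> j \<le> m \<Longrightarrow> y i < y j"
    and x_even_nonneg: "\<And>i. i \<in> {1..l} \<Longrightarrow> even (x i) \<and> x i \<ge> 0"
    and y_even_pos: "\<And>j. j \<in> {1..m} \<Longrightarrow> even (y j) \<and> y j > 0"
    and union_nontrivial: "X \<union> Y \<noteq> {0}"
    and X_nontrivial: "X \<noteq> {0}"
    and L_def: "L = (\<Sum>i = 1..l. x i)"
    and M_def: "M = (\<Sum>j = 1..m. y j)"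
    and n_def: "int n = int l * M + int m * L"
  shows "\<exists>G :: nat pair_pre_digraph.
    near_tournament G \<and> card (pverts G) = n \<and> imbalance_set G = X \<union> Y"
proof -
  define a b where "a i = nat (x i div 2)" and "b j = nat (y j div 2)" for i j
  have a: "x i = 2 * int (a i)" if "i \<in> {1..l}" for i
    using x_even_nonneg[OF that] by (auto simp: a_def)
  have b: "y j = 2 * int (b j)" "b j > 0" if "j \<in> {1..m}" for j
    using y_even_pos[OF that] by (auto simp: b_def)
  \<comment> \<open>\<open>(i, j, c)\<close> is vertex \<open>c\<close> of block
    \<open>(i, j)\<close>: the \<open>b j\<close> sources have \<open>c < b j\<close>, the
    \<open>a i\<close> sinks take the remaining indices. If \<open>a i = 0\<close>, the sources are
    isolated and still have imbalance \<open>a i\<close>.\<close>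
  define W where "W = (SIGMA i:{1..l}. SIGMA j:{1..m}. {..<a i + b j})"
  define E :: "nat \<times> nat \<times> nat \<Rightarrow> nat \<times> nat \<times> nat \<Rightarrow> bool"
    where "E = (\<lambda>(i, j, c) (i', j', c'). i = i' \<and> j = j' \<and> c < b j \<and> b j \<le> c')"
  have "asymp E"
    by (auto simp: E_def intro!: asympI)
  obtain j0 where j0: "j0 \<in> {1..m}"
    using Y_nonempty Y_def by auto
  \<comment> \<open>\<open>X \<noteq> {0}\<close> gives a positive \<open>a i0\<close>; every block
    \<open>(i0, j)\<close> then has a sink, which is how each \<open>- y j\<close> is
    attained.\<close>
  obtain i0 where i0: "i0 \<in> {1..l}" "a i0 > 0"
  proof -
    have "\<not> X \<subseteq> {0}"
      using X_nonempty X_nontrivial by blast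
    then obtain i where "i \<in> {1..l}" "x i \<noteq> 0"
      unfolding X_def by blast
    then show thesis using that a by force
  qed
  have "finite W"
    by (auto simp: W_def)
  have "(i0, j0, 0) \<in> W"
    using i0 j0 by (simp add: W_def)
  \<comment> \<open>Doubling turns the block size \<open>a i + b j\<close> into
    \<open>x i + y j\<close>.\<close>
  have "int (2 * card W) = (\<Sum>i = 1..l. \<Sum>j = 1..m. x i + y j)"
    by (simp add: W_def a b sum_distrib_left sum.distrib algebra_simps)
  also have "\<dots> = int n"
    by (simp add: n_def L_def M_def sum.distrib sum_distrib_left)
  finally have card: "2 * card W = n"
    by linarith
  have source: "2 * (int (card {z \<in> W. E (i, j, c) z}) - int (card {z \<in> W. E z (i, j, c)})) = x i"
    if "(i, j, c) \<in> W" "c < b j" for i j c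
  proof -
    have "{z \<in> W. E (i, j, c) z} = (\<lambda>c'. (i, j, c')) ` {b j..<a i + b j}"
      "{z \<in> W. E z (i, j, c)} = {}"
      using that by (auto simp: W_def E_def)
    then show ?thesis
      using that by (simp add: card_image inj_on_def a W_def)
  qed
  have sink: "2 * (int (card {z \<in> W. E (i, j, c) z}) - int (card {z \<in> W. E z (i, j, c)})) = - y j"
    if "(i, j, c) \<in> W" "\<not> c < b j" for i j c
  proof -
    have "{z \<in> W. E z (i, j, c)} = (\<lambda>c'. (i, j, c')) ` {..<b j}" "{z \<in> W. E (i, j, c) z} = {}"
      using that by (auto simp: W_def E_def)
    then show ?thesis
      using that by (simp add: card_image inj_on_def b W_def)
  qed
  have "(\<lambda>w. 2 * (int (card {z \<in> W. E w z}) - int (card {z \<in> W. E z w}))) ` W = X \<union> Y"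
    (is "?f ` W = _")
  proof (intro equalityI subsetI)
    fix d assume "d \<in> ?f ` W"
    then obtain i j c where w: "(i, j, c) \<in> W" "d = ?f (i, j, c)"
      by auto
    then have "i \<in> {1..l}" "j \<in> {1..m}"
      by (auto simp: W_def)
    then show "d \<in> X \<union> Y"
      using w source[OF w(1)] sink[OF w(1)] by (cases "c < b j") (auto simp: X_def Y_def)
  next
    fix d assume "d \<in> X \<union> Y"
    then consider i where "i \<in> {1..l}" "d = x i" | j where "j \<in> {1..m}" "d = - y j"
      by (auto simp: X_def Y_def)
    then show "d \<in> ?f ` W"
    proof cases
      case 1
      \<comment> \<open>Index 0 is a source because \<open>b j0 > 0\<close>.\<close>
      then have "(i, j0, 0) \<in> W"
        using j0 b by (auto simp: W_def)
      then show ?thesis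
        using 1 source[of i j0 0] b j0 by (intro image_eqI[where x = "(i, j0, 0)"]) auto
    next
      case 2
      \<comment> \<open>Index \<open>b j\<close> is the first sink of the block, present because
        \<open>a i0 > 0\<close>.\<close>
      then have "(i0, j, b j) \<in> W"
        using i0 by (auto simp: W_def)
      then show ?thesis
        using 2 sink[of i0 j "b j"] by (intro image_eqI[where x = "(i0, j, b j)"]) auto
    qed
  qed
  then show ?thesis
    using near_tournament_from_oriented_graph[OF \<open>finite W\<close> _ \<open>asymp E\<close>] \<open>(i0, j0, 0) \<in> W\<close> card
    by (metis empty_iff)
qed

end
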